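(* Let $F\subseteq\mathbb{Z}^2$ be an exact cluster of full affine span with $|F|<8$ and $|F|\neq 6$. Then for every $F$-tiling $T$, the orbit closure $\overline{\mathbb{Z}^2\cdot T}$ contains a $1$-periodic $F$-tiling.
   Context: A cluster is a finite subset of $\mathbb{Z}^2$. An $F$-tiling is a subset $T\subseteq\mathbb{Z}^2$ such that every element of $\mathbb{Z}^2$ has a unique representation $a+t$ with $a\in F$, $t\in T$; $F$ is exact if an $F$-tiling exists. $F$ has full affine span if $F-F=\{a-b:a,b\in F\}$ generates $\mathbb{Z}^2$ as a group. A subset $T\subseteq\mathbb{Z}^2$ is identified with its indicator $1_T\in\{0,1\}^{\mathbb{Z}^2}$ (product topology). $\mathbb{Z}^2$ acts by $(v\cdot c)(x)=c(x-v)$, and $\overline{\mathbb{Z}^2\cdot T}$ is the closure of $\{v\cdot 1_T:v\in\mathbb{Z}^2\}$. $T$ is $1$-periodic if there is a nonzero $v\in\mathbb{Z}^2$ with $T+v=T$. *)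

theory Defs
  imports
    "HOL-Analysis.Analysis"
    "HOL-Computational_Algebra.Group_Closure"
begin

type_synonym point = "int \<times> int"

definition is_cluster :: "point set \<Rightarrow> bool" where
  "is_cluster F \<longleftrightarrow> finite F"

definition is_tiling :: "point set \<Rightarrow> point set \<Rightarrow> bool" where
  "is_tiling F T \<longleftrightarrow> (\<forall>z. \<exists>!(a, t). a \<in> F \<and> t \<in> T \<and> a + t = z)"

definition exact :: "point set \<Rightarrow> bool" where
  "exact F \<longleftrightarrow> (\<exists>T. is_tiling F T)"

(* group_closure S is the additive subgroup generated by S. *)
definition full_affine_span :: "point set \<Rightarrow> bool" where
  "full_affine_span F \<longleftrightarrow> group_closure {a - b | a b. a \<in> F \<and> b \<in> F} = UNIV"

(* The alphabet {0,1} is bool, whose library topology is discrete; the library topology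
   on the function type is the product topology. *)
type_synonym config = "point \<Rightarrow> bool"

definition indicator_config :: "point set \<Rightarrow> config" where
  "indicator_config T = (\<lambda>x. x \<in> T)"

definition shift :: "point \<Rightarrow> config \<Rightarrow> config" where
  "shift v c = (\<lambda>x. c (x - v))"

definition orbit_closure :: "point set \<Rightarrow> config set" where
  "orbit_closure T = closure (range (\<lambda>v. shift v (indicator_config T)))"

definition one_periodic :: "point set \<Rightarrow> bool" where
  "one_periodic T \<longleftrightarrow> (\<exists>v. v \<noteq> 0 \<and> (\<lambda>t. t + v) ` T = T)"

end

theory Submission
  imports Defs "HOL-Computational_Algebra.Primes" "HOL-Number_Theory.Cong"
begin

text \<open>
  In every case the tiling \<open>T\<close> itself has a nonzero period, so it serves as its own witness in the
  orbit closure. The possible sizes of \<open>F\<close> are \<open>1\<close>, the primes \<open>2, 3, 5, 7\<close>, and \<open>4\<close>. Write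
  \<open>t\<close> for the indicator function of \<open>T\<close>, and \<open>X\<^sup>v\<close> for the translation of functions by \<open>v\<close>.
  Then \<open>L = (\<Sum>a\<in>F. X\<^sup>a)\<close> satisfies \<open>L t = 1\<close>.

  If \<open>|F| = p\<close> is prime, the Frobenius congruence (lemma \<open>window_sum_frobenius\<close>) gives
  \<open>(\<Sum>a\<in>F. X\<^bsup>pa\<^esup>) t = L\<^sup>p t = p\<^bsup>p-1\<^esup> = 0\<close> modulo \<open>p\<close>. The left-hand side counts elements of a
  set of size \<open>p\<close>, so at each point all or none of the translates are occupied, and \<open>p (b - a)\<close> is
  a period for all \<open>a, b \<in> F\<close>.

  Let \<open>F = {0, a, b, c}\<close>. The set \<open>T\<close> also tiles with \<open>-F\<close> (lemma \<open>tiling_reflect\<close>). Comparing the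
  two tilings shows that \<open>(1 + X\<^sup>c) t\<close> is periodic under \<open>c' = a + b - c\<close> (lemma \<open>quad_pair\<close>), and
  likewise for \<open>a' = b + c - a\<close> and \<open>b' = a + c - b\<close>. This reflects the fact that
  four complex numbers of modulus one with sum zero form two pairs of opposite numbers.
  So \<open>t\<close> is annihilated by \<open>(1 - X\<^bsup>2c\<^esup>) (1 - X\<^bsup>c'\<^esup>)\<close>. A function with values in \<open>{0, 1}\<close>
  cannot have both differences nonzero at one point (lemma \<open>no_crossing\<close>), and hence on
  each coset of \<open>\<langle>c, c'\<rangle>\<close> it is periodic under \<open>c'\<close> or under \<open>2c\<close>. If one of the primed vectors is
  zero, then \<open>F\<close> is a parallelogram whose sides generate the whole plane, and the same argument
  applies to its two sides. If \<open>c\<close> and \<open>c'\<close>, or two of the primed vectors, are parallel, a second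
  difference of \<open>t\<close> in one direction vanishes, which makes \<open>t\<close> periodic
  (lemma \<open>parallel_period\<close>). In the remaining case, whatever alternative holds for each of the three
  pairs, two of the three resulting periods are linearly independent, so \<open>t\<close> is doubly periodic
  (lemma \<open>generic_period\<close>).
\<close>

section \<open>Integer multiples and periods in the plane\<close>

definition smul :: "int \<Rightarrow> point \<Rightarrow> point" where
  "smul k v = (k * fst v, k * snd v)"

definition cross :: "point \<Rightarrow> point \<Rightarrow> int" where
  "cross u v = fst u * snd v - snd u * fst v"

lemma fst_smul [simp]: "fst (smul k v) = k * fst v"
  and snd_smul [simp]: "snd (smul k v) = k * snd v"
  by (simp_all add: smul_def)

lemmas point_simps = prod_eq_iff algebra_simps

lemma smul_eq_0_iff [simp]: "smul k v = 0 \<longleftrightarrow> k = 0 \<or> v = 0"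
  by (auto simp: prod_eq_iff)

lemma smul_0 [simp]: "smul 0 v = 0"
  and smul_1 [simp]: "smul 1 v = v"
  by (simp_all add: prod_eq_iff)

lemma int_periodic:
  fixes g :: "int \<Rightarrow> 'a"
  assumes step: "\<And>j. g j = g (j + s)"
  shows "g j = g (j + k * s)"
proof -
  have nat: "g j = g (j + int n * s)" for j n
  proof (induction n)
    case (Suc n)
    have "j + int n * s + s = j + int (Suc n) * s"
      by (simp add: algebra_simps)
    with Suc step[of "j + int n * s"] show ?case by metis
  qed simp
  show ?thesis
  proof (cases "k \<ge> 0")
    case True
    then show ?thesis using nat[of j "nat k"] by simp
  next
    case False
    then have "j + k * s + int (nat (- k)) * s = j" by simp
    then show ?thesis using nat[of "j + k * s" "nat (- k)"] by metis
  qed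
qed

lemma periodic_smul:
  assumes "\<And>x. f x = f (x - v)"
  shows "f x = f (x - smul k v)"
proof -
  have "f (x - smul j v) = f (x - smul (j + 1) v)" for j
  proof -
    have "x - smul j v - v = x - smul (j + 1) v"
      by (simp add: point_simps)
    then show ?thesis using assms[of "x - smul j v"] by metis
  qed
  from int_periodic[of "\<lambda>j. f (x - smul j v)", OF this, of 0 k] show ?thesis by simp
qed

lemma subgroup_smul:
  assumes diff: "\<And>u v. P u \<Longrightarrow> P v \<Longrightarrow> P (u - v)" and "P u"
  shows "P (smul k u)"
proof -
  have zero: "P 0" using diff[of u u] \<open>P u\<close> by simp
  have nat: "P (smul (int n) u)" for n
  proof (induction n)
    case (Suc n)
    have "smul (int (Suc n)) u = smul (int n) u - (0 - u)"
      by (simp add: point_simps)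
    then show ?case using Suc diff zero \<open>P u\<close> by metis
  qed (simp add: zero)
  show ?thesis
  proof (cases "k \<ge> 0")
    case True
    then show ?thesis using nat[of "nat k"] by simp
  next
    case False
    then have "smul k u = 0 - smul (int (nat (- k))) u"
      by (simp add: point_simps)
    then show ?thesis using nat diff zero by metis
  qed
qed

text \<open>By Cramer's rule, a subgroup containing \<open>u\<close> and \<open>v\<close> contains every multiple of their
  determinant on the horizontal axis.\<close>

lemma subgroup_axis:
  assumes diff: "\<And>u v. P u \<Longrightarrow> P v \<Longrightarrow> P (u - v)" and "P u" "P v" "cross u v dvd k"
  shows "P (k, 0)"
proof -
  obtain m where m: "k = cross u v * m" using assms(4) by blast
  have "(k, 0) = smul (m * snd v) u - smul (m * snd u) v"
    by (simp add: m cross_def point_simps)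
  moreover have "P (smul (m * snd v) u)" "P (smul (m * snd u) v)"
    using subgroup_smul[of P, OF diff] assms(2,3) by blast+
  ultimately show ?thesis using diff by metis
qed

lemma parallel_common_multiple:
  assumes "u \<noteq> 0" "v \<noteq> 0" "cross u v = 0"
  obtains m n where "smul m u = smul n v" "smul m u \<noteq> 0"
proof (cases "fst u = 0")
  case False
  have *: "smul (fst v) u = smul (fst u) v"
    using \<open>cross u v = 0\<close> by (simp add: cross_def point_simps)
  have "smul (fst v) u \<noteq> 0" unfolding * using False \<open>v \<noteq> 0\<close> by simp
  with * show thesis by (rule that)
next
  case True
  have *: "smul (snd v) u = smul (snd u) v"
    using \<open>cross u v = 0\<close> by (simp add: cross_def point_simps)
  have "snd u \<noteq> 0" using True \<open>u \<noteq> 0\<close> by (simp add: prod_eq_iff)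
  then have "smul (snd v) u \<noteq> 0" unfolding * using \<open>v \<noteq> 0\<close> by simp
  with * show thesis by (rule that)
qed

text \<open>For a common nonzero multiple \<open>w\<close> of \<open>u\<close> and \<open>v\<close>, the hypothesis forces
  \<open>(1 - X\<^sup>w)\<^sup>2 t = 0\<close>; three values in \<open>{0, 1}\<close> in arithmetic progression are equal.\<close>

lemma parallel_period:
  fixes t :: "point \<Rightarrow> int"
  assumes range: "\<And>x. t x \<in> {0, 1}"
    and mixed: "\<And>x. t x - t (x - u) = t (x - v) - t (x - u - v)"
    and "u \<noteq> 0" "v \<noteq> 0" "cross u v = 0"
  shows "\<exists>w. w \<noteq> 0 \<and> (\<forall>x. t x = t (x - w))"
proof -
  obtain m n where mn: "smul m u = smul n v" "smul m u \<noteq> 0"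
    using assms(3-5) by (rule parallel_common_multiple)
  define w where "w = smul m u"
  have "t x - t (x - u) = t (x - w) - t (x - w - u)" for x
    using periodic_smul[of "\<lambda>x. t x - t (x - u)" v x n] mixed mn(1)
    by (simp add: w_def diff_diff_add add.commute)
  then have "t x - t (x - w) = t (x - u) - t (x - u - w)" for x
    by (simp add: algebra_simps)
  then have second: "t x - t (x - w) = t (x - w) - t (x - w - w)" for x
    using periodic_smul[of "\<lambda>x. t x - t (x - w)" u x m] by (simp add: w_def)
  have "t x = t (x - w)" for x
    using second[of x] range[of x] range[of "x - w"] range[of "x - w - w"] by auto
  then show ?thesis using mn(2) w_def by blast
qed

section \<open>A dichotomy for zero-one functions\<close>

lemma no_crossing:
  fixes t :: "point \<Rightarrow> int"
  assumes range: "\<And>x. t x \<in> {0, 1}"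
    and mixed: "\<And>x. t x - t (x - u) = t (x - v) - t (x - u - v)"
  shows "t r = t (r - u) \<or> t r = t (r - v)"
  \<comment> \<open>Otherwise \<open>t (r - u) = t (r - v) = 1 - t r\<close>, which makes \<open>t (r - u - v) = 2 - 3 * t r\<close>.\<close>
  using mixed[of r] range[of r] range[of "r - u"] range[of "r - v"] range[of "r - u - v"]
  by auto

text \<open>The support of \<open>(1 - X\<^sup>u) t\<close> is a union of lines in direction \<open>w\<close>, and that of
  \<open>(1 - X\<^sup>v) t\<close> a union of lines in direction \<open>z\<close>. Inside one coset of \<open>\<langle>w, z\<rangle>\<close> such lines always
  meet, and a meeting point would violate \<open>no_crossing\<close>.\<close>

lemma coset_dichotomy:
  fixes t :: "point \<Rightarrow> int"
  assumes range: "\<And>x. t x \<in> {0, 1}"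
    and mixed: "\<And>x. t x - t (x - u) = t (x - v) - t (x - u - v)"
    and supp_u: "\<And>x. t x = t (x - u) \<longleftrightarrow> t (x - w) = t (x - w - u)"
    and supp_v: "\<And>x. t x = t (x - v) \<longleftrightarrow> t (x - z) = t (x - z - v)"
  shows "(\<forall>i j. t (x - smul i w - smul j z) = t (x - smul i w - smul j z - u)) \<or>
         (\<forall>i j. t (x - smul i w - smul j z) = t (x - smul i w - smul j z - v))"
proof (rule ccontr)
  assume "\<not> ?thesis"
  then obtain i j k l where
    u: "t (x - smul i w - smul j z) \<noteq> t (x - smul i w - smul j z - u)" and
    v: "t (x - smul k w - smul l z) \<noteq> t (x - smul k w - smul l z - v)"
    by blast
  define r where "r = x - smul k w - smul j z"
  have r1: "x - smul i w - smul j z - smul (k - i) w = r"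
    and r2: "x - smul k w - smul l z - smul (j - l) z = r"
    by (simp_all add: r_def point_simps)
  have "t r \<noteq> t (r - u)"
    using periodic_smul[of "\<lambda>y. t y = t (y - u)" w, OF supp_u] u r1 by metis
  moreover have "t r \<noteq> t (r - v)"
    using periodic_smul[of "\<lambda>y. t y = t (y - v)" z, OF supp_v] v r2 by metis
  ultimately show False using no_crossing[OF range mixed] by blast
qed

section \<open>Tilings by four points\<close>

text \<open>For the indicator function \<open>t\<close> of \<open>T\<close>, the two equations say that both \<open>{0, a, b, c}\<close> and
  its negative tile with \<open>T\<close>.\<close>

definition quad :: "(point \<Rightarrow> int) \<Rightarrow> point \<Rightarrow> point \<Rightarrow> point \<Rightarrow> bool" where
  "quad t a b c \<longleftrightarrow> (\<forall>x. t x \<in> {0, 1}) \<and>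
     (\<forall>x. t x + t (x - a) + t (x - b) + t (x - c) = 1) \<and>
     (\<forall>x. t x + t (x + a) + t (x + b) + t (x + c) = 1)"

lemma quad_rotate: "quad t a b c \<Longrightarrow> quad t b c a"
  unfolding quad_def by (simp add: add_ac)

lemma quad_range: "quad t a b c \<Longrightarrow> t x \<in> {0, 1}"
  unfolding quad_def by blast

text \<open>The tiling by \<open>F\<close> says \<open>(1 + X\<^sup>c) t = 1 - (X\<^sup>a + X\<^sup>b) t\<close>. By the tiling by \<open>-F\<close>, seen from
  \<open>x - a - b\<close>, the right-hand side is also \<open>X\<^bsup>a+b-c\<^esup> (1 + X\<^sup>c) t\<close>.\<close>

lemma quad_pair:
  assumes "quad t a b c"
  shows "t x + t (x - c) = t (x - (a + b - c)) + t (x - (a + b - c) - c)"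
proof -
  define y where "y = x - (a + b - c) - c"
  have "t x + t (x - a) + t (x - b) + t (x - c) = 1"
    using assms unfolding quad_def by blast
  moreover have "t y + t (y + a) + t (y + b) + t (y + c) = 1"
    using assms unfolding quad_def by blast
  moreover have "y + a = x - b" "y + b = x - a" "y + c = x - (a + b - c)"
    by (simp_all add: y_def)
  ultimately have "t x + t (x - c) = t (x - (a + b - c)) + t y" by simp
  then show ?thesis by (simp only: y_def)
qed

lemma quad_mixed:
  assumes "quad t a b c"
  shows "t x - t (x - (a + b - c)) = t (x - smul 2 c) - t (x - (a + b - c) - smul 2 c)"
proof -
  have eqs: "x - c - c = x - smul 2 c" "x - c - (a + b - c) = x - (a + b - c) - c"
    "x - (a + b - c) - c - c = x - (a + b - c) - smul 2 c"
    by (simp_all add: point_simps)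
  show ?thesis
    using quad_pair[OF assms, of x] quad_pair[OF assms, of "x - c"] unfolding eqs by linarith
qed

text \<open>For the square \<open>{0, a} + {0, b}\<close> the function \<open>(1 - X\<^bsup>2a\<^esup>) t\<close> changes sign under
  \<open>X\<^sup>b\<close>, because \<open>(1 - X\<^sup>a) (1 + X\<^sup>a) (1 + X\<^sup>b) t = (1 - X\<^sup>a) 1 = 0\<close>; so its support is invariant under
  \<open>b\<close>. As \<open>a\<close> and \<open>b\<close> generate everything, the dichotomy is global.\<close>

lemma parallelogram_period:
  assumes quad: "quad t a b (a + b)"
    and gen: "\<And>y. \<exists>i j. y = smul i a + smul j b"
    and "a \<noteq> 0" "b \<noteq> 0"
  shows "\<exists>w. w \<noteq> 0 \<and> (\<forall>x. t x = t (x - w))"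
proof -
  have sum: "t x + t (x - a) + t (x - b) + t (x - a - b) = 1" for x
    using quad unfolding quad_def diff_diff_add by blast
  have anti_b: "t x - t (x - smul 2 a) = - (t (x - b) - t (x - b - smul 2 a))" for x
  proof -
    have eqs: "x - a - a = x - smul 2 a" "x - smul 2 a - b = x - b - smul 2 a"
      by (simp_all add: point_simps)
    show ?thesis using sum[of x] sum[of "x - a"] unfolding eqs by linarith
  qed
  have anti_a: "t x - t (x - smul 2 b) = - (t (x - a) - t (x - a - smul 2 b))" for x
  proof -
    have eqs: "x - b - b = x - smul 2 b" "x - b - a = x - a - b" "x - a - b - b = x - a - smul 2 b"
      by (simp_all add: point_simps)
    show ?thesis using sum[of x] sum[of "x - b"] unfolding eqs by linarith
  qed
  have mixed: "t x - t (x - smul 2 a) = t (x - smul 2 b) - t (x - smul 2 a - smul 2 b)" for x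
  proof -
    have eqs: "x - b - b = x - smul 2 b" "x - smul 2 b - smul 2 a = x - smul 2 a - smul 2 b"
      by (simp_all add: point_simps)
    show ?thesis using anti_b[of x] anti_b[of "x - b"] unfolding eqs by linarith
  qed
  have "(\<forall>i j. t (0 - smul i b - smul j a) = t (0 - smul i b - smul j a - smul 2 a)) \<or>
        (\<forall>i j. t (0 - smul i b - smul j a) = t (0 - smul i b - smul j a - smul 2 b))"
  proof (rule coset_dichotomy)
    show "t x \<in> {0, 1}" for x using quad by (rule quad_range)
    show "t x = t (x - smul 2 a) \<longleftrightarrow> t (x - b) = t (x - b - smul 2 a)" for x
      using anti_b[of x] by auto
    show "t x = t (x - smul 2 b) \<longleftrightarrow> t (x - a) = t (x - a - smul 2 b)" for x
      using anti_a[of x] by auto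
  qed (rule mixed)
  moreover have "\<exists>i j. x = 0 - smul i b - smul j a" for x
  proof -
    obtain i j where "- x = smul i a + smul j b" using gen by blast
    then have "x = 0 - smul j b - smul i a" by (auto simp: point_simps)
    then show ?thesis by blast
  qed
  ultimately have "(\<forall>x. t x = t (x - smul 2 a)) \<or> (\<forall>x. t x = t (x - smul 2 b))"
    by metis
  then show ?thesis using \<open>a \<noteq> 0\<close> \<open>b \<noteq> 0\<close> by (metis smul_eq_0_iff zero_neq_numeral)
qed

text \<open>A lattice \<open>M \<int>\<^sup>2\<close> inside \<open>\<langle>c, c'\<rangle>\<close> makes the alternatives for different pairs comparable:
  the period \<open>c'\<close> or \<open>2c\<close> found on a coset of \<open>\<langle>c, c'\<rangle>\<close> becomes, after multiplication by \<open>M\<close>, a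
  translation within a coset of \<open>M \<int>\<^sup>2\<close>.\<close>

lemma quad_coset_period:
  fixes x :: point
  assumes quad: "quad t a b c" and M: "cross c (a + b - c) dvd M"
  defines "per \<equiv> \<lambda>w. \<forall>y. t (x - smul M y) = t (x - smul M (y + w))"
  shows "per (a + b - c) \<or> per (smul 2 c)"
proof -
  define d where "d = a + b - c"
  obtain m where m: "M = cross c d * m" using M unfolding d_def by blast
  have cramer: "x - smul (m * cross y d) c - smul (m * cross c y) d = x - smul M y" for y
    by (simp add: m cross_def point_simps)
  have pair: "t y + t (y - c) = t (y - d) + t (y - d - c)" for y
    using quad_pair[OF quad] by (simp add: d_def)
  have "(\<forall>i j. t (x - smul i c - smul j d) = t (x - smul i c - smul j d - d)) \<or>
        (\<forall>i j. t (x - smul i c - smul j d) = t (x - smul i c - smul j d - smul 2 c))"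
  proof (rule coset_dichotomy)
    show "t y \<in> {0, 1}" for y using quad by (rule quad_range)
    show "t y - t (y - d) = t (y - smul 2 c) - t (y - d - smul 2 c)" for y
      using quad_mixed[OF quad] by (simp add: d_def)
    show "t y = t (y - d) \<longleftrightarrow> t (y - c) = t (y - c - d)" for y
    proof -
      have eq: "y - c - d = y - d - c" by simp
      show ?thesis using pair[of y] unfolding eq by linarith
    qed
    show "t y = t (y - smul 2 c) \<longleftrightarrow> t (y - d) = t (y - d - smul 2 c)" for y
    proof -
      have eqs: "y - c - c = y - smul 2 c" "y - c - d = y - d - c"
        "y - d - c - c = y - d - smul 2 c"
        by (simp_all add: point_simps)
      show ?thesis using pair[of y] pair[of "y - c"] unfolding eqs by linarith
    qed
  qed
  then show ?thesis
  proof
    assume eq: "\<forall>i j. t (x - smul i c - smul j d) = t (x - smul i c - smul j d - d)"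
    have step: "x - smul i c - smul j d - d = x - smul i c - smul (j + 1) d" for i j
      by (simp add: point_simps)
    have line: "t (x - smul i c - smul j d) = t (x - smul i c - smul (j + M) d)" for i j
      using int_periodic[of "\<lambda>j. t (x - smul i c - smul j d)" 1 j M] eq unfolding step by simp
    have "t (x - smul M y) = t (x - smul (m * cross y d) c - smul (m * cross c y + M) d)" for y
      unfolding cramer[symmetric] by (rule line)
    moreover have "x - smul (m * cross y d) c - smul (m * cross c y + M) d = x - smul M (y + d)" for y
      unfolding cramer[symmetric] by (simp add: m cross_def point_simps)
    ultimately have "t (x - smul M y) = t (x - smul M (y + d))" for y by metis
    then show ?thesis unfolding per_def d_def by blast
  next
    assume eq: "\<forall>i j. t (x - smul i c - smul j d) = t (x - smul i c - smul j d - smul 2 c)"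
    have step: "x - smul i c - smul j d - smul 2 c = x - smul (i + 2) c - smul j d" for i j
      by (simp add: point_simps)
    have line: "t (x - smul i c - smul j d) = t (x - smul (i + M * 2) c - smul j d)" for i j
      using int_periodic[of "\<lambda>i. t (x - smul i c - smul j d)" 2 i M] eq unfolding step by simp
    have "t (x - smul M y) = t (x - smul (m * cross y d + M * 2) c - smul (m * cross c y) d)" for y
      unfolding cramer[symmetric] by (rule line)
    moreover have "x - smul (m * cross y d + M * 2) c - smul (m * cross c y) d
                   = x - smul M (y + smul 2 c)" for y
      unfolding cramer[symmetric] by (simp add: m cross_def point_simps)
    ultimately have "t (x - smul M y) = t (x - smul M (y + smul 2 c))" for y by metis
    then show ?thesis unfolding per_def by blast
  qed
qed

text \<open>With \<open>\<alpha> = cross b c\<close>, \<open>\<beta> = cross c a\<close>, \<open>\<gamma> = cross a b\<close>, the hypothesis that these three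
  are distinct says that none of the pairs \<open>c, c'\<close> etc. is parallel, and the hypothesis on sums
  that no two of the primed vectors are parallel. The determinant of \<open>a'\<close> with each of
  \<open>b'\<close>, \<open>2b\<close>, \<open>c'\<close>, \<open>2c\<close> is, up to sign, twice such a sum. So two independent periods arise
  as soon as one of them is primed; and \<open>2a\<close>, \<open>2b\<close>, \<open>2c\<close> are not all parallel because at most one of
  \<open>\<alpha>, \<beta>, \<gamma>\<close> vanishes.\<close>

lemma generic_period:
  assumes quad: "quad t a b c"
    and distinct: "cross b c \<noteq> cross c a" "cross c a \<noteq> cross a b" "cross a b \<noteq> cross b c"
    and sums: "cross b c + cross c a \<noteq> 0" "cross c a + cross a b \<noteq> 0" "cross a b + cross b c \<noteq> 0"
  shows "\<exists>w. w \<noteq> 0 \<and> (\<forall>x. t x = t (x - w))"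
proof -
  define a' b' c' where "a' = b + c - a" and "b' = c + a - b" and "c' = a + b - c"
  define M where "M = cross a a' * cross b b' * cross c c'"
  define D where "D = {a', b', c', smul 2 a, smul 2 b, smul 2 c}"
  \<comment> \<open>The pair of independent periods depends on the coset; \<open>K\<close> serves all cosets at once.\<close>
  define K where "K = (\<Prod>(u, v) \<in> {(u, v) \<in> D \<times> D. cross u v \<noteq> 0}. cross u v)"
  have own: "cross a a' = cross a b - cross c a" "cross b b' = cross b c - cross a b"
    "cross c c' = cross c a - cross b c"
    by (simp_all add: a'_def b'_def c'_def cross_def algebra_simps)
  then have "M \<noteq> 0" using distinct by (simp add: M_def)
  have fin: "finite {(u, v) \<in> D \<times> D. cross u v \<noteq> 0}"
    by (rule finite_subset[of _ "D \<times> D"]) (auto simp: D_def)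
  then have "K \<noteq> 0" unfolding K_def by (auto simp: prod_zero_iff)
  have K: "cross u v dvd K" if "u \<in> D" "v \<in> D" "cross u v \<noteq> 0" for u v
    using dvd_prodI[OF fin, of "(u, v)" "\<lambda>(u, v). cross u v"] that unfolding K_def by simp
  have indep: "cross a' b' \<noteq> 0" "cross b' c' \<noteq> 0" "cross a' c' \<noteq> 0"
    "cross a' (smul 2 b) \<noteq> 0" "cross a' (smul 2 c) \<noteq> 0" "cross b' (smul 2 a) \<noteq> 0"
    "cross b' (smul 2 c) \<noteq> 0" "cross c' (smul 2 a) \<noteq> 0" "cross c' (smul 2 b) \<noteq> 0"
    using sums by (auto simp: a'_def b'_def c'_def cross_def algebra_simps)
  have indep2: "cross (smul 2 a) (smul 2 b) = 4 * cross a b"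
    "cross (smul 2 b) (smul 2 c) = 4 * cross b c" "cross (smul 2 c) (smul 2 a) = 4 * cross c a"
    by (simp_all add: cross_def algebra_simps)
  have "t x = t (x - smul M (K, 0))" for x
  proof -
    define per where "per w \<longleftrightarrow> (\<forall>y. t (x - smul M y) = t (x - smul M (y + w)))" for w
    have per_diff: "per (u - v)" if "per u" "per v" for u v
    proof -
      have "t (x - smul M y) = t (x - smul M (y + u - v))" for y
      proof -
        have "t (x - smul M y) = t (x - smul M (y + u))"
          using that(1) unfolding per_def by blast
        moreover have "t (x - smul M (y + u - v)) = t (x - smul M (y + u - v + v))"
          using that(2) unfolding per_def by blast
        ultimately show ?thesis by simp
      qed
      then show ?thesis by (simp add: per_def add_diff_eq)
    qed
    have axis: "per (K, 0)" if "per u" "per v" "u \<in> D" "v \<in> D" "cross u v \<noteq> 0" for u v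
      using subgroup_axis[of per, OF per_diff that(1,2) K[OF that(3-5)]] .
    have M_dvd: "cross c c' dvd M" "cross a a' dvd M" "cross b b' dvd M"
      by (simp_all add: M_def)
    have quads: "quad t b c a" "quad t c a b"
      using quad quad_rotate by blast+
    have pc: "per c' \<or> per (smul 2 c)"
      using quad_coset_period[OF quad, of M x] M_dvd(1) unfolding per_def c'_def by blast
    have pa: "per a' \<or> per (smul 2 a)"
      using quad_coset_period[OF quads(1), of M x] M_dvd(2) unfolding per_def a'_def by blast
    have pb: "per b' \<or> per (smul 2 b)"
      using quad_coset_period[OF quads(2), of M x] M_dvd(3) unfolding per_def b'_def by blast
    have mem: "a' \<in> D" "b' \<in> D" "c' \<in> D" "smul 2 a \<in> D" "smul 2 b \<in> D" "smul 2 c \<in> D"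
      by (simp_all add: D_def)
    have "cross (smul 2 a) (smul 2 b) \<noteq> 0 \<or> cross (smul 2 b) (smul 2 c) \<noteq> 0"
      using distinct unfolding indep2 by linarith
    then have "per (K, 0)"
      using pa pb pc axis mem indep by metis
    then have "t (x - smul M 0) = t (x - smul M (0 + (K, 0)))"
      unfolding per_def by blast
    moreover have "smul M 0 = 0" by simp
    ultimately show ?thesis by simp
  qed
  moreover have "smul M (K, 0) \<noteq> 0"
    using \<open>M \<noteq> 0\<close> \<open>K \<noteq> 0\<close> by (simp add: smul_def prod_eq_iff)
  ultimately show ?thesis by blast
qed

text \<open>The hypothesis \<open>cross b c = cross c a\<close> says that \<open>c\<close> and \<open>c' = a + b - c\<close> are parallel, which
  includes the parallelogram \<open>c' = 0\<close>.\<close>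

lemma quad_period_own_parallel:
  assumes quad: "quad t a b c"
    and gen: "\<And>y. \<exists>i j k. y = smul i a + smul j b + smul k c"
    and "a \<noteq> 0" "b \<noteq> 0" "c \<noteq> 0"
    and "cross b c = cross c a"
  shows "\<exists>w. w \<noteq> 0 \<and> (\<forall>x. t x = t (x - w))"
proof (cases "a + b - c = 0")
  case True
  then have c: "c = a + b" by simp
  show ?thesis
  proof (rule parallelogram_period)
    show "quad t a b (a + b)" using quad c by simp
    show "\<exists>i j. y = smul i a + smul j b" for y
    proof -
      obtain i j k where "y = smul i a + smul j b + smul k c" using gen by blast
      then have "y = smul (i + k) a + smul (j + k) b" by (simp add: c point_simps)
      then show ?thesis by blast
    qed
  qed (fact \<open>a \<noteq> 0\<close> \<open>b \<noteq> 0\<close>)+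
next
  case False
  show ?thesis
  proof (rule parallel_period)
    show "t x \<in> {0, 1}" for x using quad by (rule quad_range)
    show "t x - t (x - (a + b - c)) = t (x - smul 2 c) - t (x - (a + b - c) - smul 2 c)" for x
      using quad by (rule quad_mixed)
    have "cross (a + b - c) (smul 2 c) = 2 * (cross b c - cross c a)"
      by (simp add: cross_def algebra_simps)
    then show "cross (a + b - c) (smul 2 c) = 0" using \<open>cross b c = cross c a\<close> by simp
  qed (use False \<open>c \<noteq> 0\<close> in simp_all)
qed

text \<open>Here \<open>a'\<close> and \<open>b'\<close> are parallel. For a common multiple \<open>w\<close>, both \<open>(1 + X\<^sup>a) t\<close> and
  \<open>(1 + X\<^sup>b) t\<close> are \<open>w\<close>-periodic, hence so is their difference; and \<open>2 (b - a) = a' - b'\<close> is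
  parallel to \<open>w\<close> too.\<close>

lemma quad_period_primes_parallel:
  assumes quad: "quad t a b c"
    and nz: "b + c - a \<noteq> 0" "c + a - b \<noteq> 0" and "a \<noteq> b"
    and zero: "cross b c + cross c a = 0"
  shows "\<exists>w. w \<noteq> 0 \<and> (\<forall>x. t x = t (x - w))"
proof -
  have quads: "quad t b c a" "quad t c a b"
    using quad quad_rotate by blast+
  have "cross (b + c - a) (c + a - b) = 2 * (cross b c + cross c a)"
    by (simp add: cross_def algebra_simps)
  then have "cross (b + c - a) (c + a - b) = 0" using zero by simp
  with nz obtain m n where mn: "smul m (b + c - a) = smul n (c + a - b)" "smul m (b + c - a) \<noteq> 0"
    by (rule parallel_common_multiple)
  define w where "w = smul m (b + c - a)"
  have a: "t x + t (x - a) = t (x - w) + t (x - w - a)" for x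
    using periodic_smul[of "\<lambda>x. t x + t (x - a)", OF quad_pair[OF quads(1)], of x m]
    by (simp only: w_def)
  have b: "t x + t (x - b) = t (x - w) + t (x - w - b)" for x
    using periodic_smul[of "\<lambda>x. t x + t (x - b)", OF quad_pair[OF quads(2)], of x n]
    by (simp only: w_def mn(1))
  show ?thesis
  proof (rule parallel_period)
    show "t x \<in> {0, 1}" for x using quad by (rule quad_range)
    show "t x - t (x - (b - a)) = t (x - w) - t (x - (b - a) - w)" for x
    proof -
      have eqs: "x + a - a = x" "x + a - b = x - (b - a)" "x + a - w - a = x - w"
        "x + a - w - b = x - (b - a) - w"
        by simp_all
      show ?thesis using a[of "x + a"] b[of "x + a"] unfolding eqs by linarith
    qed
    show "b - a \<noteq> 0" using \<open>a \<noteq> b\<close> by simp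
    show "w \<noteq> 0" unfolding w_def by (rule mn(2))
    have "cross (b - a) w = m * (cross b c + cross c a)"
      by (simp add: w_def cross_def algebra_simps)
    then show "cross (b - a) w = 0" using zero by simp
  qed
qed

lemma quad_period:
  assumes quad: "quad t a b c"
    and gen: "\<And>y. \<exists>i j k. y = smul i a + smul j b + smul k c"
    and nz: "a \<noteq> 0" "b \<noteq> 0" "c \<noteq> 0" and dist: "a \<noteq> b" "b \<noteq> c" "c \<noteq> a"
  shows "\<exists>w. w \<noteq> 0 \<and> (\<forall>x. t x = t (x - w))"
proof (rule ccontr)
  assume no: "\<not> ?thesis"
  have quads: "quad t b c a" "quad t c a b"
    using quad quad_rotate by blast+
  have gen1: "\<exists>i j k. y = smul i b + smul j c + smul k a"
    and gen2: "\<exists>i j k. y = smul i c + smul j a + smul k b" for y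
    using gen[of y] by (metis add.assoc add.commute)+
  have d: "cross b c \<noteq> cross c a" "cross c a \<noteq> cross a b" "cross a b \<noteq> cross b c"
    using quad_period_own_parallel[OF quad gen nz] quad_period_own_parallel[OF quads(1) gen1 nz(2,3,1)]
      quad_period_own_parallel[OF quads(2) gen2 nz(3,1,2)] no by blast+
  have "cross c (a + b - c) = cross c a - cross b c" "cross a (b + c - a) = cross a b - cross c a"
    "cross b (c + a - b) = cross b c - cross a b" "\<And>u. cross u 0 = 0"
    by (simp_all add: cross_def algebra_simps)
  then have p: "a + b - c \<noteq> 0" "b + c - a \<noteq> 0" "c + a - b \<noteq> 0"
    using d by (metis eq_iff_diff_eq_0)+
  have "cross b c + cross c a \<noteq> 0" "cross c a + cross a b \<noteq> 0" "cross a b + cross b c \<noteq> 0"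
    using quad_period_primes_parallel[OF quad p(2,3) dist(1)]
      quad_period_primes_parallel[OF quads(1) p(3,1) dist(2)]
      quad_period_primes_parallel[OF quads(2) p(1,2) dist(3)] no by blast+
  then show False using generic_period[OF quad d] no by blast
qed

section \<open>Tilings as convolution equations\<close>

definition ind :: "point set \<Rightarrow> point \<Rightarrow> int" where
  "ind T x = of_bool (x \<in> T)"

definition window_sum :: "point set \<Rightarrow> (point \<Rightarrow> int) \<Rightarrow> point \<Rightarrow> int" where
  "window_sum F f = (\<lambda>x. \<Sum>a\<in>F. f (x - a))"

lemma tiling_unique:
  assumes "is_tiling F T"
  shows "\<exists>a\<in>F. z - a \<in> T \<and> (\<forall>b\<in>F. z - b \<in> T \<longrightarrow> b = a)"
proof -
  have "\<exists>!p. fst p \<in> F \<and> snd p \<in> T \<and> fst p + snd p = z"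
    using assms unfolding is_tiling_def case_prod_beta by blast
  then obtain p where p: "fst p \<in> F" "snd p \<in> T" "fst p + snd p = z"
    and uniq: "\<And>q. fst q \<in> F \<and> snd q \<in> T \<and> fst q + snd q = z \<Longrightarrow> q = p"
    by (elim ex1E) blast
  show ?thesis
  proof (intro bexI[of _ "fst p"] conjI ballI impI)
    show "z - fst p \<in> T" using p(2) by (simp add: p(3)[symmetric])
    show "b = fst p" if "b \<in> F" "z - b \<in> T" for b
      using uniq[of "(b, z - b)"] that by auto
  qed (fact p(1))
qed

lemma tiling_window_sum:
  assumes "finite F" "is_tiling F T"
  shows "window_sum F (ind T) x = 1"
proof -
  obtain a where "a \<in> F" "x - a \<in> T" "\<forall>b\<in>F. x - b \<in> T \<longrightarrow> b = a"
    using tiling_unique[OF assms(2), of x] by blast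
  then have "x - b \<in> T \<longleftrightarrow> b = a" if "b \<in> F" for b
    using that by blast
  then have "window_sum F (ind T) x = (\<Sum>b\<in>F. if b = a then 1 else 0)"
    unfolding window_sum_def ind_def by (intro sum.cong refl) simp
  then show ?thesis using \<open>finite F\<close> \<open>a \<in> F\<close> by simp
qed

text \<open>The translates of \<open>-F\<close> by \<open>T\<close> are disjoint, because \<open>-F\<close> has the same differences as \<open>F\<close>. So
  \<open>r x = (\<Sum>a\<in>F. t (x + a))\<close> is at most \<open>1\<close>. Since its sum over each translated window is \<open>|F|\<close>,
  it equals \<open>1\<close> everywhere.\<close>

lemma tiling_reflect:
  assumes "finite F" "is_tiling F T"
  shows "(\<Sum>a\<in>F. ind T (x + a)) = 1"
proof -
  define r where "r x = (\<Sum>a\<in>F. ind T (x + a))" for x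
  have le: "r x \<le> 1" for x
  proof -
    have "a = b" if "a \<in> F" "b \<in> F" "x + a \<in> T" "x + b \<in> T" for a b
    proof -
      obtain d where "\<forall>e\<in>F. x + a + b - e \<in> T \<longrightarrow> e = d"
        using tiling_unique[OF assms(2), of "x + a + b"] by blast
      moreover have "x + a + b - a = x + b" "x + a + b - b = x + a" by simp_all
      ultimately show ?thesis using that by metis
    qed
    then have "card {a \<in> F. x + a \<in> T} \<le> 1"
      using assms(1) by (auto simp: card_le_Suc0_iff_eq)
    moreover have "r x = int (card {a \<in> F. x + a \<in> T})"
      using assms(1) by (simp add: r_def ind_def sum.If_cases of_bool_def Int_def)
    ultimately show ?thesis by linarith
  qed
  obtain b where b: "b \<in> F" using tiling_unique[OF assms(2), of 0] by blast
  have "(\<Sum>d\<in>F. r (x + b - d)) = (\<Sum>a\<in>F. window_sum F (ind T) (x + b + a))"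
    unfolding r_def window_sum_def by (subst sum.swap) (simp add: algebra_simps)
  then have "(\<Sum>d\<in>F. 1 - r (x + b - d)) = 0"
    using assms by (simp add: tiling_window_sum sum_subtractf)
  then have "1 - r (x + b - b) = 0"
    using le assms(1) b by (subst (asm) sum_nonneg_eq_0_iff) auto
  then show ?thesis by (simp add: r_def)
qed

lemma card_four_obtain:
  assumes "card F = 4"
  obtains p q r s where "F = {p, q, r, s}" "distinct [p, q, r, s]"
proof -
  have "finite F" using assms card_ge_0_finite[of F] by simp
  then obtain xs where xs: "set xs = F" "distinct xs" using finite_distinct_list by blast
  then have "length xs = 4" using assms distinct_card by metis
  then obtain p q r s where "xs = [p, q, r, s]"
    by (auto simp: numeral_eq_Suc length_Suc_conv)
  then show thesis using that xs by auto
qed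

lemma tiling_card_four_period:
  assumes "card F = 4" "full_affine_span F" "is_tiling F T"
  shows "\<exists>w. w \<noteq> 0 \<and> (\<forall>x. ind T x = ind T (x - w))"
proof -
  obtain p q r s where F: "F = {p, q, r, s}" and dist: "distinct [p, q, r, s]"
    using assms(1) by (rule card_four_obtain)
  then have fin: "finite F" by simp
  define a b c where "a = q - p" and "b = r - p" and "c = s - p"
  have shifts: "x + p - p = x" "x + p - q = x - a" "x + p - r = x - b" "x + p - s = x - c"
    "x - p + p = x" "x - p + q = x + a" "x - p + r = x + b" "x - p + s = x + c" for x
    by (simp_all add: a_def b_def c_def)
  have "quad (ind T) a b c"
    unfolding quad_def
  proof (intro conjI allI)
    show "ind T x \<in> {0, 1}" for x by (simp add: ind_def)
    show "ind T x + ind T (x - a) + ind T (x - b) + ind T (x - c) = 1" for x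
      using tiling_window_sum[OF fin assms(3), of "x + p"] dist
      by (simp add: F window_sum_def shifts add.assoc)
    show "ind T x + ind T (x + a) + ind T (x + b) + ind T (x + c) = 1" for x
      using tiling_reflect[OF fin assms(3), of "x - p"] dist
      by (simp add: F shifts add.assoc)
  qed
  moreover have "\<exists>i j k. y = smul i a + smul j b + smul k c" for y
  proof -
    have F_span: "\<exists>i j k. u = p + smul i a + smul j b + smul k c" if "u \<in> F" for u
    proof -
      have "p = p + smul 0 a + smul 0 b + smul 0 c" "q = p + smul 1 a + smul 0 b + smul 0 c"
        "r = p + smul 0 a + smul 1 b + smul 0 c" "s = p + smul 0 a + smul 0 b + smul 1 c"
        by (simp_all add: a_def b_def c_def)
      then show ?thesis using that unfolding F by blast
    qed
    have span_diff: "\<exists>i j k. u - v = smul i a + smul j b + smul k c"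
      if span: "\<exists>i j k. u = z + smul i a + smul j b + smul k c"
        "\<exists>i j k. v = z + smul i a + smul j b + smul k c" for u v z
    proof -
      obtain i j k i' j' k' where "u = z + smul i a + smul j b + smul k c"
        "v = z + smul i' a + smul j' b + smul k' c"
        using span by blast
      then have "u - v = smul (i - i') a + smul (j - j') b + smul (k - k') c"
        by (simp add: point_simps)
      then show ?thesis by blast
    qed
    have "y \<in> group_closure {u - v | u v. u \<in> F \<and> v \<in> F}"
      using assms(2) by (simp add: full_affine_span_def)
    then show ?thesis
    proof induction
      case (base y)
      then consider "y = 0" | u v where "y = u - v" "u \<in> F" "v \<in> F" by blast
      then show ?case
      proof cases
        case 1
        then have "y = smul 0 a + smul 0 b + smul 0 c" by simp
        then show ?thesis by blast
      next
        case 2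
        show ?thesis unfolding 2(1) using F_span[OF 2(2)] F_span[OF 2(3)] by (rule span_diff)
      qed
    next
      case (diff y z)
      then show ?case using span_diff[of y 0 z] by simp
    qed
  qed
  ultimately show ?thesis
    by (rule quad_period) (use dist in \<open>auto simp: a_def b_def c_def\<close>)
qed

section \<open>The Frobenius congruence and clusters of prime size\<close>

lemma sum_choose_Suc:
  fixes u :: "nat \<Rightarrow> nat \<Rightarrow> int"
  shows "(\<Sum>k\<le>Suc n. int (Suc n choose k) * u k (Suc n - k)) =
    (\<Sum>k\<le>n. int (n choose k) * u k (Suc (n - k))) +
    (\<Sum>k\<le>n. int (n choose k) * u (Suc k) (n - k))"
proof -
  have "(\<Sum>k\<le>n. int (n choose k) * u k (Suc (n - k))) =
        (\<Sum>k\<le>Suc n. int (n choose k) * u k (Suc n - k))"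
    by (simp add: binomial_eq_0 Suc_diff_le)
  also have "\<dots> = u 0 (Suc n) + (\<Sum>k\<le>n. int (n choose Suc k) * u (Suc k) (n - k))"
    by (subst sum.atMost_Suc_shift) simp
  finally show ?thesis
    by (subst sum.atMost_Suc_shift) (simp add: sum.distrib algebra_simps)
qed

text \<open>The binomial theorem for the commuting operators \<open>X\<^sup>a\<close> and \<open>window_sum F\<close>.\<close>

lemma window_sum_binomial:
  assumes "finite F" "a \<notin> F"
  shows "(window_sum (insert a F) ^^ n) f x =
    (\<Sum>k\<le>n. int (n choose k) * (window_sum F ^^ k) f (x - smul (int (n - k)) a))"
proof (induction n arbitrary: x)
  case (Suc n)
  define u where "u k m = (window_sum F ^^ k) f (x - smul (int m) a)" for k m
  have "(\<Sum>b\<in>F. (window_sum (insert a F) ^^ n) f (x - b)) =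
      (\<Sum>k\<le>n. int (n choose k) * u (Suc k) (n - k))"
    unfolding Suc u_def funpow.simps comp_def window_sum_def[of F "(window_sum F ^^ _) f"]
    by (subst sum.swap) (simp add: sum_distrib_left algebra_simps)
  moreover have "(window_sum (insert a F) ^^ n) f (x - a) =
      (\<Sum>k\<le>n. int (n choose k) * u k (Suc (n - k)))"
  proof -
    have eq: "x - a - smul (int m) a = x - smul (int (Suc m)) a" for m
      by (simp add: point_simps)
    show ?thesis unfolding Suc u_def by (simp only: eq)
  qed
  moreover have "(window_sum (insert a F) ^^ Suc n) f x =
      (window_sum (insert a F) ^^ n) f (x - a) + (\<Sum>b\<in>F. (window_sum (insert a F) ^^ n) f (x - b))"
    using assms by (simp add: window_sum_def[of "insert a F" "(window_sum (insert a F) ^^ n) f"])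
  ultimately have "(window_sum (insert a F) ^^ Suc n) f x =
      (\<Sum>k\<le>Suc n. int (Suc n choose k) * u k (Suc n - k))"
    by (simp only: sum_choose_Suc)
  then show ?case unfolding u_def .
qed simp

lemma window_sum_frobenius:
  assumes "prime p" "finite F"
  shows "[(window_sum F ^^ p) f x = (\<Sum>a\<in>F. f (x - smul (int p) a))] (mod int p)"
  using assms(2)
proof (induction F)
  case empty
  obtain n where "p = Suc n" using prime_gt_0_nat[OF assms(1)] gr0_conv_Suc by blast
  then show ?case by (simp add: window_sum_def)
next
  case (insert a F)
  define h where "h k = int (p choose k) * (window_sum F ^^ k) f (x - smul (int (p - k)) a)" for k
  have "0 < p" using assms(1) by (rule prime_gt_0_nat)
  have "{..p} = insert 0 (insert p {0<..<p})" by auto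
  then have "(window_sum (insert a F) ^^ p) f x = h 0 + h p + sum h {0<..<p}"
    using \<open>0 < p\<close> insert by (simp add: window_sum_binomial h_def)
  moreover have "int p dvd sum h {0<..<p}"
  proof (rule dvd_sum)
    fix k assume "k \<in> {0<..<p}"
    then have "p dvd (p choose k)" using assms(1) by (intro dvd_choose_prime) auto
    then show "int p dvd h k" by (simp add: h_def)
  qed
  ultimately have "[(window_sum (insert a F) ^^ p) f x = h 0 + h p] (mod int p)"
    by (simp add: cong_iff_dvd_diff)
  also have "h 0 + h p = f (x - smul (int p) a) + (window_sum F ^^ p) f x"
    by (simp add: h_def)
  also have "[\<dots> = f (x - smul (int p) a) + (\<Sum>a\<in>F. f (x - smul (int p) a))] (mod int p)"
    using insert.IH by (intro cong_add cong_refl)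
  finally show ?case using insert by simp
qed

lemma window_sum_const: "(window_sum F ^^ n) (\<lambda>_. k) = (\<lambda>_. int (card F) ^ n * k)"
proof (induction n)
  case (Suc n)
  have "window_sum F (\<lambda>_. m) = (\<lambda>_. int (card F) * m)" for m
    by (simp add: window_sum_def)
  with Suc show ?case by (simp add: mult.assoc)
qed simp

text \<open>The Frobenius congruence makes the number of \<open>d \<in> F\<close> with \<open>x - p d \<in> T\<close> a multiple of
  \<open>p = |F|\<close>, so it is \<open>p\<close> once it is positive.\<close>

lemma tiling_prime_translate:
  assumes "prime (card F)" "is_tiling F T" "a \<in> F" "b \<in> F"
    and "x - smul (int (card F)) a \<in> T"
  shows "x - smul (int (card F)) b \<in> T"
proof -
  define p where "p = card F"
  define A where "A = {d \<in> F. x - smul (int p) d \<in> T}"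
  have p: "prime p" "2 \<le> p" using assms(1) prime_ge_2_nat by (auto simp: p_def)
  have fin: "finite F"
    using p(2) card_ge_0_finite[of F] unfolding p_def by linarith
  obtain n where n: "p = Suc (Suc n)" using p(2) by (metis add_2_eq_Suc le_Suc_ex)
  have one: "window_sum F (ind T) = (\<lambda>_. 1)"
    using tiling_window_sum[OF fin assms(2)] by (intro ext)
  have "(window_sum F ^^ p) (ind T) = (window_sum F ^^ Suc n) (window_sum F (ind T))"
    unfolding n funpow_Suc_right[of "Suc n"] comp_def ..
  also have "\<dots> = (\<lambda>_. int p ^ Suc n * 1)"
    unfolding one p_def by (rule window_sum_const)
  finally have "(window_sum F ^^ p) (ind T) x = int p ^ Suc n" by simp
  moreover have "(\<Sum>d\<in>F. ind T (x - smul (int p) d)) = int (card A)"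
    using fin by (simp add: A_def ind_def sum.If_cases of_bool_def Int_def)
  ultimately have "[int p ^ Suc n = int (card A)] (mod int p)"
    using window_sum_frobenius[OF p(1) fin, of "ind T" x] by simp
  then have "int p dvd int (card A)"
    using cong_dvd_iff[of "int p ^ Suc n" "int (card A)" "int p"] by simp
  then have "p dvd card A" by simp
  moreover have "a \<in> A" "finite A" using assms(3,5) fin by (auto simp: A_def p_def)
  then have "card A > 0" by (auto simp: card_gt_0_iff)
  ultimately have "card F \<le> card A" by (auto simp: p_def dest: dvd_imp_le)
  then have "A = F" using fin by (intro card_seteq) (auto simp: A_def)
  then show ?thesis using assms(4) by (auto simp: A_def p_def)
qed

lemma tiling_prime_period:
  assumes "prime (card F)" "is_tiling F T"
  shows "\<exists>w. w \<noteq> 0 \<and> (\<forall>x. ind T x = ind T (x - w))"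
proof -
  have "card F \<ge> 2" using assms(1) by (rule prime_ge_2_nat)
  moreover from this have "finite F" by (intro card_ge_0_finite) linarith
  ultimately have "\<not> (\<forall>a\<in>F. \<forall>b\<in>F. a = b)"
    using card_le_Suc0_iff_eq[of F] by linarith
  then obtain a b where ab: "a \<in> F" "b \<in> F" "a \<noteq> b" by blast
  define w where "w = smul (int (card F)) (b - a)"
  have "ind T x = ind T (x - w)" for x
  proof -
    define y where "y = x + smul (int (card F)) a"
    have y: "y - smul (int (card F)) a = x" "y - smul (int (card F)) b = x - w"
      by (simp_all add: y_def w_def point_simps)
    then show ?thesis
      using tiling_prime_translate[OF assms ab(1,2), of y]
        tiling_prime_translate[OF assms ab(2,1), of y]
      by (auto simp: ind_def)
  qed
  moreover have "w \<noteq> 0" using ab \<open>card F \<ge> 2\<close> by (simp add: w_def)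
  ultimately show ?thesis by blast
qed

lemma tiling_card_one_period:
  assumes "card F = 1" "is_tiling F T"
  shows "\<exists>w. w \<noteq> 0 \<and> (\<forall>x. ind T x = ind T (x - w))"
proof -
  obtain a where F: "F = {a}" using assms(1) by (rule card_1_singletonE)
  have "x \<in> T" for x
    using tiling_unique[OF assms(2), of "x + a"] by (simp add: F)
  then have "ind T x = ind T (x - (1, 0))" for x by (simp add: ind_def)
  then show ?thesis by (intro exI[of _ "(1, 0)"]) (simp add: prod_eq_iff)
qed

section \<open>The tiling in its own orbit closure\<close>

lemma one_periodicI:
  assumes "w \<noteq> 0" "\<And>x. ind T x = ind T (x - w)"
  shows "one_periodic T"
proof -
  have shift: "x \<in> T \<longleftrightarrow> x - w \<in> T" for x
    using assms(2)[of x] by (simp add: ind_def of_bool_def split: if_splits)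
  have "(\<lambda>x. x + w) ` T = T"
  proof (intro equalityI subsetI)
    show "y \<in> T" if y: "y \<in> (\<lambda>x. x + w) ` T" for y
    proof -
      obtain x where x: "x \<in> T" "y = x + w" using y by blast
      then have "y - w \<in> T" by simp
      then show ?thesis using shift by blast
    qed
    show "y \<in> (\<lambda>x. x + w) ` T" if "y \<in> T" for y
      using that shift[of y] by (intro image_eqI[of _ _ "y - w"]) simp_all
  qed
  then show ?thesis using assms(1) unfolding one_periodic_def by blast
qed

lemma indicator_in_orbit_closure: "indicator_config T \<in> orbit_closure T"
proof -
  have "indicator_config T = shift 0 (indicator_config T)" by (simp add: shift_def)
  then have "indicator_config T \<in> range (\<lambda>v. shift v (indicator_config T))"
    by (rule range_eqI)
  then show ?thesis unfolding orbit_closure_def by (rule subsetD[OF closure_subset])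
qed

theorem mainTheorem3:
  fixes F T :: "point set"
  assumes "is_cluster F"
    and "exact F"
    and "full_affine_span F"
    and "card F < 8"
    and "card F \<noteq> 6"
    and "is_tiling F T"
  shows "\<exists>S. indicator_config S \<in> orbit_closure T \<and> is_tiling F S \<and> one_periodic S"
proof -
  have "finite F" using assms(1) by (simp add: is_cluster_def)
  moreover have "F \<noteq> {}" using tiling_unique[OF assms(6), of 0] by blast
  ultimately have "card F \<noteq> 0" by simp
  then consider "card F = 1" | "card F = 4" | "card F \<in> {2, 3, 5, 7}"
    using assms(4,5) by fastforce
  then have "\<exists>w. w \<noteq> 0 \<and> (\<forall>x. ind T x = ind T (x - w))"
  proof cases
    case 1
    then show ?thesis using assms(6) by (rule tiling_card_one_period)
  next
    case 2
    then show ?thesis using assms(3,6) by (rule tiling_card_four_period)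
  next
    case 3
    then have "prime (card F)" by auto
    then show ?thesis using assms(6) by (rule tiling_prime_period)
  qed
  then have "one_periodic T" using one_periodicI by blast
  then show ?thesis using assms(6) indicator_in_orbit_closure by blast
qed

end
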